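(* Fix $(s,i)\in[t,T]\times\mathcal S$ and $(\Pi,P)\in\mathbb S^n\times\mathbb S^n$, and let the matrices $\hat{\mathcal S}=\binom{\hat{\mathcal S}_1}{\hat{\mathcal S}_2}$ and $\hat{\mathcal R}=\begin{pmatrix}\hat{\mathcal R}_{11}&\hat{\mathcal R}_{12}\\ \hat{\mathcal R}_{12}^\top&\hat{\mathcal R}_{22}\end{pmatrix}$ (all evaluated at $(s,i)$) be as defined in the context. (i) If $\hat{\mathcal R}_{22}$ and $\hat{\mathcal R}_{11}-\hat{\mathcal R}_{12}\hat{\mathcal R}_{22}^{-1}\hat{\mathcal R}_{12}^\top$ are invertible, then $\hat{\mathcal R}$ is invertible and $$\hat{\mathcal S}^\top\hat{\mathcal R}^{-1}\hat{\mathcal S}=\hat{\mathcal S}_2^\top\hat{\mathcal R}_{22}^{-1}\hat{\mathcal S}_2+\big(\hat{\mathcal S}_1-\hat{\mathcal R}_{12}\hat{\mathcal R}_{22}^{-1}\hat{\mathcal S}_2\big)^\top\big(\hat{\mathcal R}_{11}-\hat{\mathcal R}_{12}\hat{\mathcal R}_{22}^{-1}\hat{\mathcal R}_{12}^\top\big)^{-1}\big(\hat{\mathcal S}_1-\hat{\mathcal R}_{12}\hat{\mathcal R}_{22}^{-1}\hat{\mathcal S}_2\big).$$ (ii) If $\hat{\mathcal R}_{11}$ and $\hat{\mathcal R}_{22}-\hat{\mathcal R}_{12}^\top\hat{\mathcal R}_{11}^{-1}\hat{\mathcal R}_{12}$ are invertible, then $\hat{\mathcal R}$ is invertible and $$\hat{\mathcal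 S}^\top\hat{\mathcal R}^{-1}\hat{\mathcal S}=\hat{\mathcal S}_1^\top\hat{\mathcal R}_{11}^{-1}\hat{\mathcal S}_1+\big(\hat{\mathcal S}_2-\hat{\mathcal R}_{12}^\top\hat{\mathcal R}_{11}^{-1}\hat{\mathcal S}_1\big)^\top\big(\hat{\mathcal R}_{22}-\hat{\mathcal R}_{12}^\top\hat{\mathcal R}_{11}^{-1}\hat{\mathcal R}_{12}\big)^{-1}\big(\hat{\mathcal S}_2-\hat{\mathcal R}_{12}^\top\hat{\mathcal R}_{11}^{-1}\hat{\mathcal S}_1\big).$$
   Context: $\mathcal S=\{1,\dots,D\}$ is a finite set, $0\le t<T$, $\gamma>0$, $\mathbb S^n$ is the set of real symmetric $n\times n$ matrices. At each $(s,i)$ the following real matrices are given: $C,\bar C\in\mathbb R^{n\times n}$; $B=(B_1\ B_2)$, $D=(D_1\ D_2)$, $\bar D=(\bar D_1\ \bar D_2)\in\mathbb R^{n\times(m+n_v)}$; $S=\binom{S_1}{S_2}\in\mathbb R^{(m+n_v)\times n}$; $R_1\in\mathbb S^m$, $R_2\in\mathbb S^{n_v}$; $R_\gamma=\mathrm{diag}(R_1,\,R_2-\gamma^2I)$. Blocks with index $1$ and $2$ have sizes $m$ and $n_v$. With all coefficients evaluated at $(s,i)$, $$\hat{\mathcal S}:=B^\top P+D^\top PC+\bar D^\top\Pi\bar C+S,\qquad \hat{\mathcal R}:=R_\gamma+D^\top PD+\bar D^\top\Pi\bar D,$$ partitioned as $\hat{\mathcal S}=\binom{\hat{\mathcal S}_1}{\hat{\mathcal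 S}_2}$ with $\hat{\mathcal S}_1\in\mathbb R^{m\times n}$, $\hat{\mathcal S}_2\in\mathbb R^{n_v\times n}$, and $\hat{\mathcal R}$ into blocks $\hat{\mathcal R}_{11}\in\mathbb S^m$, $\hat{\mathcal R}_{12}\in\mathbb R^{m\times n_v}$, $\hat{\mathcal R}_{22}\in\mathbb S^{n_v}$. *)

theory Defs
  imports "HOL-Analysis.Analysis"
begin

definition sym_matrices :: "(real ^ 'n ^ 'n) set" where
  "sym_matrices = {A. transpose A = A}"

text \<open>A matrix with \<open>m + n\<^sub>v\<close> rows or columns is indexed by a sum type \<open>'m + 'v\<close>:
  \<open>Inl\<close> is the index-1 block (size \<open>m\<close>), \<open>Inr\<close> the index-2 block (size \<open>n\<^sub>v\<close>).
  Recall that \<open>real ^ 'c ^ 'r\<close> has rows \<open>'r\<close> and columns \<open>'c\<close>.\<close>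

definition hcat :: "real ^ 'm ^ 'r \<Rightarrow> real ^ 'v ^ 'r \<Rightarrow> real ^ ('m::finite + 'v::finite) ^ 'r" where
  "hcat A1 A2 = (\<chi> i j. case j of Inl k \<Rightarrow> A1 $ i $ k | Inr k \<Rightarrow> A2 $ i $ k)"

definition vcat :: "real ^ 'c ^ 'm \<Rightarrow> real ^ 'c ^ 'v \<Rightarrow> real ^ 'c ^ ('m::finite + 'v::finite)" where
  "vcat A1 A2 = (\<chi> i. case i of Inl k \<Rightarrow> A1 $ k | Inr k \<Rightarrow> A2 $ k)"

definition block_diag :: "real ^ 'm ^ 'm \<Rightarrow> real ^ 'v ^ 'v \<Rightarrow> real ^ ('m::finite + 'v::finite) ^ ('m::finite + 'v::finite)" where
  "block_diag A1 A2 = vcat (hcat A1 0) (hcat 0 A2)"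

definition row_block1 :: "real ^ 'c ^ ('m::finite + 'v::finite) \<Rightarrow> real ^ 'c ^ 'm" where
  "row_block1 A = (\<chi> i. A $ Inl i)"

definition row_block2 :: "real ^ 'c ^ ('m::finite + 'v::finite) \<Rightarrow> real ^ 'c ^ 'v" where
  "row_block2 A = (\<chi> i. A $ Inr i)"

definition block11 :: "real ^ ('m::finite + 'v::finite) ^ ('m::finite + 'v::finite) \<Rightarrow> real ^ 'm ^ 'm" where
  "block11 A = (\<chi> i j. A $ Inl i $ Inl j)"

definition block12 :: "real ^ ('m::finite + 'v::finite) ^ ('m::finite + 'v::finite) \<Rightarrow> real ^ 'v ^ 'm" where
  "block12 A = (\<chi> i j. A $ Inl i $ Inr j)"

definition block22 :: "real ^ ('m::finite + 'v::finite) ^ ('m::finite + 'v::finite) \<Rightarrow> real ^ 'v ^ 'v" where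
  "block22 A = (\<chi> i j. A $ Inr i $ Inr j)"

definition R_gamma :: "real \<Rightarrow> real ^ 'm ^ 'm \<Rightarrow> real ^ 'v ^ 'v \<Rightarrow> real ^ ('m::finite + 'v::finite) ^ ('m::finite + 'v::finite)" where
  "R_gamma \<gamma> R1 R2 = block_diag R1 (R2 - \<gamma>\<^sup>2 *\<^sub>R mat 1)"

text \<open>\<open>\<Pi>\<^sub>0\<close> stands for the matrix \<open>\<Pi>\<close>, since a bare \<open>\<Pi>\<close> is the product binder of the library;
  \<open>Cb\<close> and \<open>Db\<close> stand for the barred matrices.\<close>

definition S_hat ::
  "real ^ ('m::finite + 'v::finite) ^ 'n \<Rightarrow> real ^ 'n ^ 'n \<Rightarrow> real ^ 'n ^ 'n \<Rightarrow> real ^ ('m::finite + 'v::finite) ^ 'n \<Rightarrow>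
   real ^ ('m::finite + 'v::finite) ^ 'n \<Rightarrow> real ^ 'n ^ ('m::finite + 'v::finite) \<Rightarrow> real ^ 'n ^ 'n \<Rightarrow> real ^ 'n ^ 'n \<Rightarrow>
   real ^ 'n ^ ('m::finite + 'v::finite)" where
  "S_hat B C Cb D Db S \<Pi>\<^sub>0 P =
     transpose B ** P + transpose D ** P ** C + transpose Db ** \<Pi>\<^sub>0 ** Cb + S"

definition R_hat ::
  "real ^ ('m::finite + 'v::finite) ^ ('m::finite + 'v::finite) \<Rightarrow> real ^ ('m::finite + 'v::finite) ^ 'n \<Rightarrow> real ^ ('m::finite + 'v::finite) ^ 'n \<Rightarrow>
   real ^ 'n ^ 'n \<Rightarrow> real ^ 'n ^ 'n \<Rightarrow> real ^ ('m::finite + 'v::finite) ^ ('m::finite + 'v::finite)" where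
  "R_hat Rg D Db \<Pi>\<^sub>0 P = Rg + transpose D ** P ** D + transpose Db ** \<Pi>\<^sub>0 ** Db"

end

(* The solution X of R X = Y is written down block by block: eliminating the block with invertible
   pivot leaves an equation for the other block governed by the Schur complement. With Y = I this
   shows that R is invertible, and with Y = S it gives S^T R^-1 S = S^T X explicitly. Part (ii) is
   the same elimination with the roles of the two blocks exchanged. *)
theory Submission
  imports Defs
begin

section \<open>Matrix algebra and inverses\<close>

lemma matrix_diff_ldistrib:
  fixes A :: "'a::ring_1 ^ 'n ^ 'm" and B C :: "'a ^ 'p ^ 'n"
  shows "A ** (B - C) = A ** B - A ** C"
  by (simp add: vec_eq_iff matrix_matrix_mult_def algebra_simps sum_subtractf)

lemma matrix_diff_rdistrib:
  fixes A B :: "'a::ring_1 ^ 'n ^ 'm" and C :: "'a ^ 'p ^ 'n"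
  shows "(A - B) ** C = A ** C - B ** C"
  by (simp add: vec_eq_iff matrix_matrix_mult_def algebra_simps sum_subtractf)

lemma transpose_plus: "transpose (A + B) = transpose A + transpose B"
  by (simp add: vec_eq_iff transpose_def)

lemma transpose_minus: "transpose (A - B) = transpose A - transpose B"
  by (simp add: vec_eq_iff transpose_def)

lemma matrix_inv_mul:
  fixes A :: "'a::semiring_1 ^ 'n ^ 'n"
  assumes "invertible A"
  shows "A ** matrix_inv A = mat 1" "matrix_inv A ** A = mat 1"
proof -
  have "\<exists>B. A ** B = mat 1 \<and> B ** A = mat 1"
    using assms by (simp add: invertible_def)
  then have "A ** matrix_inv A = mat 1 \<and> matrix_inv A ** A = mat 1"
    unfolding matrix_inv_def by (rule someI_ex)
  then show "A ** matrix_inv A = mat 1" "matrix_inv A ** A = mat 1"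
    by simp_all
qed

text \<open>Transposing \<open>A ** matrix_inv A = mat 1\<close> makes the transposed inverse a left
  inverse of the symmetric \<open>A\<close>; multiplying by \<open>matrix_inv A\<close> on the right
  identifies the two.\<close>

lemma transpose_matrix_inv_symmetric:
  fixes A :: "'a::comm_semiring_1 ^ 'n ^ 'n"
  assumes "invertible A" and "transpose A = A"
  shows "transpose (matrix_inv A) = matrix_inv A"
proof -
  have "transpose (matrix_inv A) ** A = mat 1"
    by (metis assms matrix_inv_mul(1) matrix_transpose_mul transpose_mat)
  then show ?thesis
    by (metis assms(1) matrix_inv_mul(1) matrix_mul_assoc matrix_mul_lid matrix_mul_rid)
qed

text \<open>Block elimination with pivot \<open>E\<close>, stated for separate blocks so that either
  diagonal block of a symmetric matrix can be the pivot. The third conclusion is the quadratic form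
  that the solution yields when the right-hand side is paired with it.\<close>

lemma schur_complement_solution:
  fixes A :: "real ^ 'm ^ 'm" and B :: "real ^ 'v ^ 'm" and E :: "real ^ 'v ^ 'v"
    and Y1 :: "real ^ 'c ^ 'm" and Y2 :: "real ^ 'c ^ 'v"
  assumes E: "invertible E" and symE: "transpose E = E"
    and K: "invertible (A - B ** matrix_inv E ** transpose B)"
  obtains X1 X2 where
    "A ** X1 + B ** X2 = Y1"
    "transpose B ** X1 + E ** X2 = Y2"
    "transpose Y1 ** X1 + transpose Y2 ** X2 =
      transpose Y2 ** matrix_inv E ** Y2 +
      transpose (Y1 - B ** matrix_inv E ** Y2) **
        matrix_inv (A - B ** matrix_inv E ** transpose B) ** (Y1 - B ** matrix_inv E ** Y2)"
proof -
  define F where "F = matrix_inv E"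
  define W where "W = Y1 - B ** F ** Y2"
  \<comment> \<open>The second equation forces this \<open>X2\<close>; inserting it into the first
    leaves \<open>(A - B ** F ** transpose B) ** X1 = W\<close>, which forces this
    \<open>X1\<close>.\<close>
  define X1 where "X1 = matrix_inv (A - B ** F ** transpose B) ** W"
  define X2 where "X2 = F ** (Y2 - transpose B ** X1)"
  have EF: "E ** F = mat 1" and symF: "transpose F = F"
    using E symE by (simp_all add: F_def matrix_inv_mul transpose_matrix_inv_symmetric)
  have "(A - B ** F ** transpose B) ** X1 = W"
    using K by (simp add: X1_def F_def matrix_mul_assoc matrix_inv_mul)
  then have "A ** X1 + B ** X2 = Y1"
    by (simp add: X2_def W_def matrix_diff_ldistrib matrix_diff_rdistrib matrix_mul_assoc
        algebra_simps)
  moreover have "transpose B ** X1 + E ** X2 = Y2"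
    by (simp add: X2_def matrix_mul_assoc EF)
  moreover have "transpose Y1 ** X1 + transpose Y2 ** X2 =
      transpose Y2 ** F ** Y2 + transpose W ** matrix_inv (A - B ** F ** transpose B) ** W"
  proof -
    \<comment> \<open>After expanding \<open>X2\<close>, the terms containing \<open>X1\<close> have
      left factor \<open>transpose Y1 - transpose Y2 ** F ** transpose B\<close>. This is
      \<open>transpose W\<close> because \<open>F\<close> is symmetric.\<close>
    have "transpose Y1 ** X1 + transpose Y2 ** X2 = transpose Y2 ** F ** Y2 + transpose W ** X1"
      by (simp add: X2_def W_def matrix_diff_ldistrib matrix_diff_rdistrib matrix_mul_assoc
          transpose_minus matrix_transpose_mul symF)
    then show ?thesis
      by (simp only: X1_def matrix_mul_assoc)
  qed
  ultimately show thesis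
    unfolding W_def F_def by (rule that)
qed

section \<open>Block calculus for matrices indexed by a sum type\<close>

lemma symmetric_nth:
  assumes "transpose A = A"
  shows "A $ i $ j = A $ j $ i"
proof -
  have "transpose A $ i $ j = A $ j $ i"
    by (simp add: transpose_def)
  then show ?thesis
    by (simp only: assms)
qed

lemma sum_UNIV_Plus:
  fixes f :: "'a::finite + 'b::finite \<Rightarrow> 'c::comm_monoid_add"
  shows "sum f UNIV = (\<Sum>x\<in>UNIV. f (Inl x)) + (\<Sum>x\<in>UNIV. f (Inr x))"
  by (subst UNIV_Plus_UNIV[symmetric], subst sum.Plus) (simp_all add: comp_def)

lemma row_block_vcat:
  "row_block1 (vcat X1 X2) = X1" "row_block2 (vcat X1 X2) = X2"
  by (simp_all add: row_block1_def row_block2_def vcat_def vec_eq_iff)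

lemma row_blocks_eqI:
  assumes "row_block1 X = row_block1 Y" and "row_block2 X = row_block2 Y"
  shows "X = Y"
proof -
  have "X $ k = Y $ k" for k
    using assms by (cases k) (simp_all add: row_block1_def row_block2_def vec_eq_iff)
  then show ?thesis
    by (simp add: vec_eq_iff)
qed

lemma row_block1_mul:
  "row_block1 (A ** X) = block11 A ** row_block1 X + block12 A ** row_block2 X"
  by (simp add: vec_eq_iff matrix_matrix_mult_def row_block1_def row_block2_def block11_def
      block12_def sum_UNIV_Plus)

text \<open>Symmetry turns the lower left entries, at \<open>Inr\<close> and \<open>Inl\<close>,
  into entries of the transposed upper right block.\<close>

lemma row_block2_mul:
  assumes "transpose A = A"
  shows "row_block2 (A ** X) = transpose (block12 A) ** row_block1 X + block22 A ** row_block2 X"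
  by (simp add: vec_eq_iff matrix_matrix_mult_def row_block1_def row_block2_def block22_def
      block12_def transpose_def sum_UNIV_Plus symmetric_nth[OF assms, of "Inr _" "Inl _"])

text \<open>Splitting the summation index into its two summands relates
  \<open>transpose S ** X\<close> to the two-term expression in
  \<open>schur_complement_solution\<close>.\<close>

lemma transpose_mul_row_blocks:
  "transpose Y ** X =
    transpose (row_block1 Y) ** row_block1 X + transpose (row_block2 Y) ** row_block2 X"
  by (simp add: vec_eq_iff matrix_matrix_mult_def row_block1_def row_block2_def transpose_def
      sum_UNIV_Plus)

lemma transpose_blocks:
  assumes "transpose A = A"
  shows "transpose (block11 A) = block11 A" "transpose (block22 A) = block22 A"
  by (simp_all add: vec_eq_iff block11_def block22_def transpose_def symmetric_nth[OF assms])

text \<open>The choice \<open>Y = mat 1\<close> gives a right inverse, which suffices for a square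
  real matrix. Then any solution of \<open>R ** X = S\<close> equals
  \<open>matrix_inv R ** S\<close>, so the form can be read off without computing the
  inverse.\<close>

lemma invertible_quadratic_form:
  fixes R :: "real ^ 'k ^ 'k" and S :: "real ^ 'c ^ 'k"
    and Q :: "real ^ 'c ^ 'c"
  assumes "\<And>Y :: real ^ 'k ^ 'k. \<exists>X. R ** X = Y"
    and "\<exists>X. R ** X = S \<and> transpose S ** X = Q"
  shows "invertible R \<and> transpose S ** matrix_inv R ** S = Q"
proof -
  have inv: "invertible R"
    using assms(1)[of "mat 1"] invertible_right_inverse by blast
  moreover obtain X where X: "R ** X = S" "transpose S ** X = Q"
    using assms(2) by blast
  have "matrix_inv R ** S = X"
    using inv by (simp add: X(1)[symmetric] matrix_mul_assoc matrix_inv_mul)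
  with X(2) inv show ?thesis
    by (simp add: matrix_mul_assoc[symmetric])
qed

section \<open>The Schur complement formulas for the two choices of pivot\<close>

lemma schur_complement_22:
  fixes R :: "real ^ ('m::finite + 'v::finite) ^ ('m + 'v)" and S :: "real ^ 'c ^ ('m + 'v)"
  assumes symR: "transpose R = R" and E: "invertible (block22 R)"
    and K: "invertible (block11 R - block12 R ** matrix_inv (block22 R) ** transpose (block12 R))"
  shows "invertible R \<and> transpose S ** matrix_inv R ** S =
      transpose (row_block2 S) ** matrix_inv (block22 R) ** row_block2 S +
      transpose (row_block1 S - block12 R ** matrix_inv (block22 R) ** row_block2 S) **
        matrix_inv (block11 R - block12 R ** matrix_inv (block22 R) ** transpose (block12 R)) **
        (row_block1 S - block12 R ** matrix_inv (block22 R) ** row_block2 S)"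
proof (rule invertible_quadratic_form)
  fix Y :: "real ^ ('m + 'v) ^ ('m + 'v)"
  obtain X1 X2 where
    "block11 R ** X1 + block12 R ** X2 = row_block1 Y"
    "transpose (block12 R) ** X1 + block22 R ** X2 = row_block2 Y"
    by (rule schur_complement_solution[OF E transpose_blocks(2)[OF symR] K,
          of "row_block1 Y" "row_block2 Y"]) (rule that)
  \<comment> \<open>The two block equations are exactly the upper and lower row blocks of this
    one.\<close>
  then have "R ** vcat X1 X2 = Y"
    by (intro row_blocks_eqI) (simp_all add: row_block1_mul row_block2_mul[OF symR] row_block_vcat)
  then show "\<exists>X. R ** X = Y" ..
next
  obtain X1 X2 where X:
    "block11 R ** X1 + block12 R ** X2 = row_block1 S"
    "transpose (block12 R) ** X1 + block22 R ** X2 = row_block2 S"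
    "transpose (row_block1 S) ** X1 + transpose (row_block2 S) ** X2 =
      transpose (row_block2 S) ** matrix_inv (block22 R) ** row_block2 S +
      transpose (row_block1 S - block12 R ** matrix_inv (block22 R) ** row_block2 S) **
        matrix_inv (block11 R - block12 R ** matrix_inv (block22 R) ** transpose (block12 R)) **
        (row_block1 S - block12 R ** matrix_inv (block22 R) ** row_block2 S)" (is "_ = ?Q")
    using schur_complement_solution[OF E transpose_blocks(2)[OF symR] K] by blast
  from X(1,2) have "R ** vcat X1 X2 = S"
    by (intro row_blocks_eqI) (simp_all add: row_block1_mul row_block2_mul[OF symR] row_block_vcat)
  moreover have "transpose S ** vcat X1 X2 = ?Q"
    unfolding transpose_mul_row_blocks[of S] row_block_vcat by (rule X(3))
  ultimately show "\<exists>X. R ** X = S \<and> transpose S ** X = ?Q"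
    by blast
qed

lemma schur_complement_11:
  fixes R :: "real ^ ('m::finite + 'v::finite) ^ ('m + 'v)" and S :: "real ^ 'c ^ ('m + 'v)"
  assumes symR: "transpose R = R" and E: "invertible (block11 R)"
    and K: "invertible (block22 R - transpose (block12 R) ** matrix_inv (block11 R) ** block12 R)"
  shows "invertible R \<and> transpose S ** matrix_inv R ** S =
      transpose (row_block1 S) ** matrix_inv (block11 R) ** row_block1 S +
      transpose (row_block2 S - transpose (block12 R) ** matrix_inv (block11 R) ** row_block1 S) **
        matrix_inv (block22 R - transpose (block12 R) ** matrix_inv (block11 R) ** block12 R) **
        (row_block2 S - transpose (block12 R) ** matrix_inv (block11 R) ** row_block1 S)"
proof (rule invertible_quadratic_form)
  \<comment> \<open>The pivot is now \<open>block11 R\<close> and the coupling block is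
    \<open>transpose (block12 R)\<close>, whose transpose collapses to \<open>block12 R\<close>. The
    unknowns therefore appear in the order \<open>X2\<close>, \<open>X1\<close>, and commutativity
    of addition restores the order of the blocks.\<close>
  note sol = schur_complement_solution[OF E transpose_blocks(1)[OF symR],
      of "block22 R" "transpose (block12 R)", unfolded transpose_transpose, OF K]
  {
    fix Y :: "real ^ ('m + 'v) ^ ('m + 'v)"
    obtain X2 X1 where
      "block22 R ** X2 + transpose (block12 R) ** X1 = row_block2 Y"
      "block12 R ** X2 + block11 R ** X1 = row_block1 Y"
      by (rule sol[of "row_block2 Y" "row_block1 Y"]) (rule that)
    then have "R ** vcat X1 X2 = Y"
      by (intro row_blocks_eqI)
      (simp_all add: row_block1_mul row_block2_mul[OF symR] row_block_vcat add.commute)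
    then show "\<exists>X. R ** X = Y" ..
  }
  obtain X2 X1 where X:
    "block22 R ** X2 + transpose (block12 R) ** X1 = row_block2 S"
    "block12 R ** X2 + block11 R ** X1 = row_block1 S"
    "transpose (row_block2 S) ** X2 + transpose (row_block1 S) ** X1 =
      transpose (row_block1 S) ** matrix_inv (block11 R) ** row_block1 S +
      transpose (row_block2 S - transpose (block12 R) ** matrix_inv (block11 R) ** row_block1 S) **
        matrix_inv (block22 R - transpose (block12 R) ** matrix_inv (block11 R) ** block12 R) **
        (row_block2 S - transpose (block12 R) ** matrix_inv (block11 R) ** row_block1 S)"
    (is "_ = ?Q")
    using sol by blast
  from X(1,2) have "R ** vcat X1 X2 = S"
    by (intro row_blocks_eqI)
      (simp_all add: row_block1_mul row_block2_mul[OF symR] row_block_vcat add.commute)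
  moreover have "transpose S ** vcat X1 X2 = ?Q"
    unfolding transpose_mul_row_blocks[of S] row_block_vcat X(3)[symmetric] by (rule add.commute)
  ultimately show "\<exists>X. R ** X = S \<and> transpose S ** X = ?Q"
    by blast
qed

section \<open>Symmetry of the concrete weight matrix, and the theorem\<close>

lemma transpose_R_gamma:
  assumes "transpose R1 = R1" and "transpose R2 = R2"
  shows "transpose (R_gamma \<gamma> R1 R2) = R_gamma \<gamma> R1 R2"
  by (auto simp: R_gamma_def block_diag_def vcat_def hcat_def transpose_def vec_eq_iff mat_def
      symmetric_nth[OF assms(1)] symmetric_nth[OF assms(2)] split: sum.split)

text \<open>The added terms are congruences of the symmetric matrices \<open>P\<close> and
  \<open>\<Pi>\<^sub>0\<close>, hence symmetric. This supplies the symmetry assumption of both Schur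
  complement formulas.\<close>

lemma transpose_R_hat:
  assumes "transpose Rg = Rg" and "transpose \<Pi>\<^sub>0 = \<Pi>\<^sub>0" and "transpose P = P"
  shows "transpose (R_hat Rg D Db \<Pi>\<^sub>0 P) = R_hat Rg D Db \<Pi>\<^sub>0 P"
  using assms by (simp add: R_hat_def transpose_plus matrix_transpose_mul matrix_mul_assoc)

theorem lemma4p2:
  fixes N i :: nat and t T s \<gamma> :: real
    and C Cb :: "real \<Rightarrow> nat \<Rightarrow> real ^ 'n ^ 'n"
    and B1 D1 Db1 :: "real \<Rightarrow> nat \<Rightarrow> real ^ 'm ^ 'n"
    and B2 D2 Db2 :: "real \<Rightarrow> nat \<Rightarrow> real ^ 'v ^ 'n"
    and S1 :: "real \<Rightarrow> nat \<Rightarrow> real ^ 'n ^ 'm"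
    and S2 :: "real \<Rightarrow> nat \<Rightarrow> real ^ 'n ^ 'v"
    and R1 :: "real \<Rightarrow> nat \<Rightarrow> real ^ 'm ^ 'm"
    and R2 :: "real \<Rightarrow> nat \<Rightarrow> real ^ 'v ^ 'v"
    and \<Pi>\<^sub>0 P :: "real ^ 'n ^ 'n"
  assumes "0 \<le> t" and "t < T" and "\<gamma> > 0"
    and "\<And>r j. r \<in> {t..T} \<Longrightarrow> j \<in> {1..N} \<Longrightarrow> R1 r j \<in> sym_matrices"
    and "\<And>r j. r \<in> {t..T} \<Longrightarrow> j \<in> {1..N} \<Longrightarrow> R2 r j \<in> sym_matrices"
    and "s \<in> {t..T}" and "i \<in> {1..N}"
    and "\<Pi>\<^sub>0 \<in> sym_matrices" and "P \<in> sym_matrices"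
  shows
    "let B = hcat (B1 s i) (B2 s i);
         D = hcat (D1 s i) (D2 s i);
         Db = hcat (Db1 s i) (Db2 s i);
         S = vcat (S1 s i) (S2 s i);
         Sh = S_hat B (C s i) (Cb s i) D Db S \<Pi>\<^sub>0 P;
         Rh = R_hat (R_gamma \<gamma> (R1 s i) (R2 s i)) D Db \<Pi>\<^sub>0 P;
         Sh1 = row_block1 Sh; Sh2 = row_block2 Sh;
         Rh11 = block11 Rh; Rh12 = block12 Rh; Rh22 = block22 Rh
     in
       (invertible Rh22 \<and>
        invertible (Rh11 - Rh12 ** matrix_inv Rh22 ** transpose Rh12) \<longrightarrow>
          invertible Rh \<and>
          transpose Sh ** matrix_inv Rh ** Sh =
            transpose Sh2 ** matrix_inv Rh22 ** Sh2 +
            transpose (Sh1 - Rh12 ** matrix_inv Rh22 ** Sh2) **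
              matrix_inv (Rh11 - Rh12 ** matrix_inv Rh22 ** transpose Rh12) **
              (Sh1 - Rh12 ** matrix_inv Rh22 ** Sh2)) \<and>
       (invertible Rh11 \<and>
        invertible (Rh22 - transpose Rh12 ** matrix_inv Rh11 ** Rh12) \<longrightarrow>
          invertible Rh \<and>
          transpose Sh ** matrix_inv Rh ** Sh =
            transpose Sh1 ** matrix_inv Rh11 ** Sh1 +
            transpose (Sh2 - transpose Rh12 ** matrix_inv Rh11 ** Sh1) **
              matrix_inv (Rh22 - transpose Rh12 ** matrix_inv Rh11 ** Rh12) **
              (Sh2 - transpose Rh12 ** matrix_inv Rh11 ** Sh1))"
proof -
  have "R1 s i \<in> sym_matrices" "R2 s i \<in> sym_matrices"
    using assms(4-7) by blast+
  then have "transpose (R1 s i) = R1 s i" "transpose (R2 s i) = R2 s i"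
    and "transpose \<Pi>\<^sub>0 = \<Pi>\<^sub>0" "transpose P = P"
    using assms(8,9) by (simp_all add: sym_matrices_def)
  \<comment> \<open>\<open>D\<close> and \<open>Db\<close> stay arbitrary here and are later
    instantiated with the concatenated blocks.\<close>
  then have sym: "transpose (R_hat (R_gamma \<gamma> (R1 s i) (R2 s i)) D Db \<Pi>\<^sub>0 P) =
      R_hat (R_gamma \<gamma> (R1 s i) (R2 s i)) D Db \<Pi>\<^sub>0 P" for D Db
    by (intro transpose_R_hat transpose_R_gamma)
  show ?thesis
    unfolding Let_def
    \<comment> \<open>With the abbreviations unfolded, each implication is a Schur complement
      formula for \<open>R_hat\<close> as the matrix and \<open>S_hat\<close> as the right-hand
      side.\<close>
    by (intro conjI[OF impI impI]; elim conjE)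
      (rule schur_complement_22[OF sym] schur_complement_11[OF sym]; assumption)+
qed

end
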